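(* Let $(L,\cdot,[-,-])$ be a nonzero $2$-dimensional Leibniz--Poisson algebra over $\mathbb C$. Then $L$ is isomorphic to one of the following algebras with basis $e_1,e_2$ (where $\alpha\in\mathbb C$). (a) Algebras with zero product $\cdot$: $L_1: [e_1,e_1]=e_2$; $L_2: [e_1,e_2]=e_1$; $L_3: [e_1,e_2]=e_2,\ [e_2,e_1]=-e_2$. (b) Algebras with nonzero product $\cdot$: $L_4: e_1\cdot e_1=e_1,\ e_2\cdot e_2=e_2$; $L_5^{\alpha}: e_1\cdot e_1=e_1,\ e_1\cdot e_2=e_2,\ [e_2,e_1]=\alpha e_2$; $L_6^{\alpha}: e_1\cdot e_1=e_1,\ [e_2,e_1]=\alpha e_2$; $L_7^{\alpha}: e_1\cdot e_1=e_2,\ [e_1,e_1]=\alpha e_2$.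
   Context: A Leibniz--Poisson algebra is a complex vector space with a commutative associative product $\cdot$ and a bilinear bracket $[-,-]$ satisfying the (right) Leibniz identity $[[x,y],z]=[[x,z],y]+[x,[y,z]]$ and the compatibility $[x\cdot y,z]=[x,z]\cdot y+x\cdot[y,z]$. It is nonzero if the two products are not both zero. Isomorphisms are linear bijections preserving both products. In multiplication tables, products of basis elements not listed are zero, except that $e_2\cdot e_1=e_1\cdot e_2$ by commutativity of $\cdot$. *)

theory Defs
  imports "HOL-Analysis.Cartesian_Space"
begin

record 'a two_product_space =
  scal :: "complex \<Rightarrow> 'a \<Rightarrow> 'a"
  mul :: "'a \<Rightarrow> 'a \<Rightarrow> 'a"
  brk :: "'a \<Rightarrow> 'a \<Rightarrow> 'a"

locale leibniz_poisson = vector_space "scal L"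
  for L :: "'a::ab_group_add two_product_space" +
  assumes mul_linear_left: "Vector_Spaces.linear (scal L) (scal L) (\<lambda>x. mul L x y)"
    and mul_linear_right: "Vector_Spaces.linear (scal L) (scal L) (\<lambda>y. mul L x y)"
    and brk_linear_left: "Vector_Spaces.linear (scal L) (scal L) (\<lambda>x. brk L x y)"
    and brk_linear_right: "Vector_Spaces.linear (scal L) (scal L) (\<lambda>y. brk L x y)"
    and mul_commute: "mul L x y = mul L y x"
    and mul_assoc: "mul L (mul L x y) z = mul L x (mul L y z)"
    and leibniz: "brk L (brk L x y) z = brk L (brk L x z) y + brk L x (brk L y z)"
    and compat: "brk L (mul L x y) z = mul L (brk L x z) y + mul L x (brk L y z)"

definition lp_nonzero :: "'a::ab_group_add two_product_space \<Rightarrow> bool" where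
  "lp_nonzero L \<longleftrightarrow> \<not> ((\<forall>x y. mul L x y = 0) \<and> (\<forall>x y. brk L x y = 0))"

definition lp_isomorphic ::
    "'a::ab_group_add two_product_space \<Rightarrow> 'b::ab_group_add two_product_space \<Rightarrow> bool"
    (infix "\<cong>\<^sub>L\<^sub>P" 50) where
  "L \<cong>\<^sub>L\<^sub>P M \<longleftrightarrow> (\<exists>f. Vector_Spaces.linear (scal L) (scal M) f \<and> bij f \<and>
     (\<forall>x y. f (mul L x y) = mul M (f x) (f y)) \<and>
     (\<forall>x y. f (brk L x y) = brk M (f x) (f y)))"

abbreviation e1 :: "complex ^ 2" where "e1 \<equiv> axis 1 1"
abbreviation e2 :: "complex ^ 2" where "e2 \<equiv> axis 2 1"

text \<open>A multiplication table lists the products \<open>((i, j), e\<^sub>i e\<^sub>j)\<close> of basis vectors; products that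
  are not listed are zero.  It is extended bilinearly to all of \<open>complex ^ 2\<close>.\<close>

type_synonym mult_table = "((2 \<times> 2) \<times> (complex ^ 2)) list"

definition table_entry :: "mult_table \<Rightarrow> 2 \<Rightarrow> 2 \<Rightarrow> complex ^ 2" where
  "table_entry T i j = (case map_of T (i, j) of None \<Rightarrow> 0 | Some v \<Rightarrow> v)"

definition table_product :: "mult_table \<Rightarrow> complex ^ 2 \<Rightarrow> complex ^ 2 \<Rightarrow> complex ^ 2" where
  "table_product T x y = (\<Sum>i\<in>UNIV. \<Sum>j\<in>UNIV. (x $ i * y $ j) *s table_entry T i j)"

lemma table_product_axis: "table_product T (axis i 1) (axis j 1) = table_entry T i j"
proof -
  have *: "(axis i (1::complex) $ k * axis j 1 $ l) *s table_entry T k l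
      = (if k = i then if l = j then table_entry T k l else 0 else 0)" for k l
    by (simp add: axis_def)
  show ?thesis
    unfolding table_product_def * by (subst sum.swap) simp
qed

definition table_algebra :: "mult_table \<Rightarrow> mult_table \<Rightarrow> (complex ^ 2) two_product_space" where
  "table_algebra M B = \<lparr>scal = (*s), mul = table_product M, brk = table_product B\<rparr>"

definition L1 :: "(complex ^ 2) two_product_space" where
  "L1 = table_algebra [] [((1, 1), e2)]"

definition L2 :: "(complex ^ 2) two_product_space" where
  "L2 = table_algebra [] [((1, 2), e1)]"

definition L3 :: "(complex ^ 2) two_product_space" where
  "L3 = table_algebra [] [((1, 2), e2), ((2, 1), - e2)]"

definition L4 :: "(complex ^ 2) two_product_space" where
  "L4 = table_algebra [((1, 1), e1), ((2, 2), e2)] []"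

definition L5 :: "complex \<Rightarrow> (complex ^ 2) two_product_space" where
  "L5 \<alpha> = table_algebra [((1, 1), e1), ((1, 2), e2), ((2, 1), e2)] [((2, 1), \<alpha> *s e2)]"

definition L6 :: "complex \<Rightarrow> (complex ^ 2) two_product_space" where
  "L6 \<alpha> = table_algebra [((1, 1), e1)] [((2, 1), \<alpha> *s e2)]"

definition L7 :: "complex \<Rightarrow> (complex ^ 2) two_product_space" where
  "L7 \<alpha> = table_algebra [((1, 1), e2)] [((1, 1), \<alpha> *s e2)]"

lemma leibniz_poisson_tables:
  "leibniz_poisson L1" "leibniz_poisson L2" "leibniz_poisson L3" "leibniz_poisson L4"
  "leibniz_poisson (L5 \<alpha>)" "leibniz_poisson (L6 \<alpha>)" "leibniz_poisson (L7 \<alpha>)"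
  unfolding leibniz_poisson_def leibniz_poisson_axioms_def Vector_Spaces.linear_def
    module_hom_def module_hom_axioms_def vector_space_def module_def
    L1_def L2_def L3_def L4_def L5_def L6_def L7_def
  by (auto simp: table_algebra_def table_product_def table_entry_def sum_2 vec_eq_iff forall_2
      axis_def algebra_simps)

end

theory Submission
  imports Defs
begin

text \<open>If the commutative product is not zero, then either some \<open>x\<close> satisfies \<open>x\<^sup>3 = 0\<close> with
  \<open>x, x\<^sup>2\<close> a basis, or there is a nonzero idempotent \<open>e\<close>.  In the second case the two Peirce
  components of \<open>e\<close> determine the product up to isomorphism.  The maps \<open>[-, z]\<close> are derivations of
  the product, so they kill idempotents and act diagonally on the remaining basis vector, and the
  Leibniz identity removes the other bracket parameters.  If the product is zero, the classification
  rests on \<open>[x, [y, y]] = 0\<close>: a nonzero square \<open>[x, x]\<close> gives a basis together with \<open>x\<close>, and if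
  all squares vanish the bracket is a Lie bracket.\<close>

locale leibniz_poisson_plane = leibniz_poisson +
  assumes dim_UNIV: "dim UNIV = 2"
begin

abbreviation smul (infixr "*\<^sub>L" 75) where "a *\<^sub>L x \<equiv> scal L a x"
abbreviation prod (infixl "\<cdot>" 70) where "x \<cdot> y \<equiv> mul L x y"
abbreviation bracket ("\<lbrakk>_,/ _\<rbrakk>") where "\<lbrakk>x, y\<rbrakk> \<equiv> brk L x y"

section \<open>Bilinearity of the two products, and bases of the plane\<close>

lemma scale_double: "a *\<^sub>L x + a *\<^sub>L x = (2 * a) *\<^sub>L x"
  by (simp only: mult_2 scale_left_distrib)

lemma mul_bilinear:
  "(x + y) \<cdot> z = x \<cdot> z + y \<cdot> z" "z \<cdot> (x + y) = z \<cdot> x + z \<cdot> y"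
  "(x - y) \<cdot> z = x \<cdot> z - y \<cdot> z" "z \<cdot> (x - y) = z \<cdot> x - z \<cdot> y"
  "(- x) \<cdot> z = - (x \<cdot> z)" "z \<cdot> (- x) = - (z \<cdot> x)"
  "(c *\<^sub>L x) \<cdot> z = c *\<^sub>L (x \<cdot> z)" "z \<cdot> (c *\<^sub>L x) = c *\<^sub>L (z \<cdot> x)"
  "0 \<cdot> z = 0" "z \<cdot> 0 = 0"
  using mul_linear_left[of z] mul_linear_right[of z]
  by (auto simp: Vector_Spaces.linear_def dest: module_hom.add module_hom.diff module_hom.neg
      module_hom.scale module_hom.zero)

lemma brk_bilinear:
  "\<lbrakk>x + y, z\<rbrakk> = \<lbrakk>x, z\<rbrakk> + \<lbrakk>y, z\<rbrakk>" "\<lbrakk>z, x + y\<rbrakk> = \<lbrakk>z, x\<rbrakk> + \<lbrakk>z, y\<rbrakk>"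
  "\<lbrakk>x - y, z\<rbrakk> = \<lbrakk>x, z\<rbrakk> - \<lbrakk>y, z\<rbrakk>" "\<lbrakk>z, x - y\<rbrakk> = \<lbrakk>z, x\<rbrakk> - \<lbrakk>z, y\<rbrakk>"
  "\<lbrakk>- x, z\<rbrakk> = - \<lbrakk>x, z\<rbrakk>" "\<lbrakk>z, - x\<rbrakk> = - \<lbrakk>z, x\<rbrakk>"
  "\<lbrakk>c *\<^sub>L x, z\<rbrakk> = c *\<^sub>L \<lbrakk>x, z\<rbrakk>" "\<lbrakk>z, c *\<^sub>L x\<rbrakk> = c *\<^sub>L \<lbrakk>z, x\<rbrakk>"
  "\<lbrakk>0, z\<rbrakk> = 0" "\<lbrakk>z, 0\<rbrakk> = 0"
  using brk_linear_left[of z] brk_linear_right[of z]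
  by (auto simp: Vector_Spaces.linear_def dest: module_hom.add module_hom.diff module_hom.neg
      module_hom.scale module_hom.zero)

text \<open>Coefficients express independence of the ordered pair, so \<open>u = v\<close> is
  excluded; \<open>independent {u, v}\<close> would allow \<open>u = v \<noteq> 0\<close>.\<close>

definition basis_pair :: "'a \<Rightarrow> 'a \<Rightarrow> bool" where
  "basis_pair u v \<longleftrightarrow> (\<forall>a b. a *\<^sub>L u + b *\<^sub>L v = 0 \<longrightarrow> a = 0 \<and> b = 0)"

lemma basis_pairD:
  assumes "basis_pair u v" "a *\<^sub>L u + b *\<^sub>L v = 0"
  shows "a = 0" "b = 0"
  using assms by (auto simp: basis_pair_def)

lemma basis_pair_eq_iff:
  assumes "basis_pair u v"
  shows "a *\<^sub>L u + b *\<^sub>L v = c *\<^sub>L u + d *\<^sub>L v \<longleftrightarrow> a = c \<and> b = d"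
proof
  assume "a *\<^sub>L u + b *\<^sub>L v = c *\<^sub>L u + d *\<^sub>L v"
  then have "(a - c) *\<^sub>L u + (b - d) *\<^sub>L v = 0"
    by (simp add: scale_left_diff_distrib algebra_simps)
  from basis_pairD[OF assms this] show "a = c \<and> b = d" by simp
qed simp

lemma basis_pair_nonzero:
  assumes "basis_pair u v" shows "u \<noteq> 0" "v \<noteq> 0"
  using basis_pairD[OF assms, of 1 0] basis_pairD[OF assms, of 0 1] by auto

lemma basis_pair_swap: "basis_pair u v \<Longrightarrow> basis_pair v u"
  unfolding basis_pair_def by (metis add.commute)

lemma basis_pair_iff:
  assumes "u \<noteq> 0" shows "basis_pair u v \<longleftrightarrow> v \<notin> range (\<lambda>c. c *\<^sub>L u)"
proof
  assume uv: "basis_pair u v"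
  show "v \<notin> range (\<lambda>c. c *\<^sub>L u)"
  proof
    assume "v \<in> range (\<lambda>c. c *\<^sub>L u)"
    then obtain c where "v = c *\<^sub>L u" by auto
    then have "c *\<^sub>L u + (- 1) *\<^sub>L v = 0" by simp
    from basis_pairD[OF uv this] show False by simp
  qed
next
  assume v: "v \<notin> range (\<lambda>c. c *\<^sub>L u)"
  show "basis_pair u v"
    unfolding basis_pair_def
  proof (intro allI impI)
    fix a b assume eq: "a *\<^sub>L u + b *\<^sub>L v = 0"
    have "b = 0"
    proof (rule ccontr)
      assume b: "b \<noteq> 0"
      have "b *\<^sub>L v = (- a) *\<^sub>L u" using eq by (simp add: eq_neg_iff_add_eq_0 add.commute)
      then have "inverse b *\<^sub>L (b *\<^sub>L v) = inverse b *\<^sub>L ((- a) *\<^sub>L u)" by (rule arg_cong)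
      then have "v = (inverse b * (- a)) *\<^sub>L u" using b by (simp del: scale_minus_left)
      with v show False by blast
    qed
    with eq assms show "a = 0 \<and> b = 0" by simp
  qed
qed

text \<open>A vector outside \<open>span {v, u}\<close> would complete it to three independent
  vectors, too many for dimension 2.\<close>

lemma basis_pair_coords:
  assumes "basis_pair u v"
  obtains a b where "x = a *\<^sub>L u + b *\<^sub>L v"
proof -
  have u: "u \<noteq> 0" and v: "v \<notin> range (\<lambda>c. c *\<^sub>L u)"
    using basis_pair_nonzero[OF assms] basis_pair_iff assms by auto
  have "u \<noteq> v" using v by (metis scale_one rangeI)
  have ind: "independent {v, u}"
    using u v by (simp add: independent_insert span_singleton)
  have "x \<in> span {v, u}"
  proof (rule ccontr)
    assume x: "x \<notin> span {v, u}"
    then have ind3: "independent {x, v, u}"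
      using ind by (rule independent_insertI)
    have "x \<noteq> v" "x \<noteq> u" using x by (auto intro: span_base)
    then have 3: "card {x, v, u} = 3" using \<open>u \<noteq> v\<close> by auto
    obtain B where B: "independent B" "UNIV \<subseteq> span B" "card B = 2"
      using basis_exists[of UNIV] dim_UNIV by metis
    then have "finite B" by (metis card.infinite zero_neq_numeral)
    from independent_span_bound[OF this ind3] B 3 show False by auto
  qed
  then show thesis
    using that by (auto simp: span_insert span_singleton eq_diff_eq algebra_simps) 
      (metis add.commute diff_add_cancel)
qed

lemma basis_pair_extend:
  assumes "u \<noteq> 0" obtains w where "basis_pair u w"
proof -
  have "\<not> UNIV \<subseteq> span {u}"
  proof
    assume "UNIV \<subseteq> span {u}"
    from dim_le_card[OF this] show False using dim_UNIV by simp
  qed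
  then show thesis using that basis_pair_iff[OF assms] by (auto simp: span_singleton)
qed

text \<open>Reduces each isomorphism to finding a basis of \<open>L\<close> with the prescribed
  table. The coordinate map \<open>g\<close> from \<open>complex ^ 2\<close> to \<open>L\<close>
  respects both products by bilinear expansion; its inverse is the isomorphism.\<close>

lemma lp_isomorphic_table_algebraI:
  fixes M B :: mult_table
  defines "M' \<equiv> table_entry M" and "B' \<equiv> table_entry B"
  assumes uv: "basis_pair u v"
    and mul: "u \<cdot> u = (M' 1 1 $ 1) *\<^sub>L u + (M' 1 1 $ 2) *\<^sub>L v"
      "u \<cdot> v = (M' 1 2 $ 1) *\<^sub>L u + (M' 1 2 $ 2) *\<^sub>L v"
      "v \<cdot> u = (M' 2 1 $ 1) *\<^sub>L u + (M' 2 1 $ 2) *\<^sub>L v"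
      "v \<cdot> v = (M' 2 2 $ 1) *\<^sub>L u + (M' 2 2 $ 2) *\<^sub>L v"
    and brk: "\<lbrakk>u, u\<rbrakk> = (B' 1 1 $ 1) *\<^sub>L u + (B' 1 1 $ 2) *\<^sub>L v"
      "\<lbrakk>u, v\<rbrakk> = (B' 1 2 $ 1) *\<^sub>L u + (B' 1 2 $ 2) *\<^sub>L v"
      "\<lbrakk>v, u\<rbrakk> = (B' 2 1 $ 1) *\<^sub>L u + (B' 2 1 $ 2) *\<^sub>L v"
      "\<lbrakk>v, v\<rbrakk> = (B' 2 2 $ 1) *\<^sub>L u + (B' 2 2 $ 2) *\<^sub>L v"
  shows "L \<cong>\<^sub>L\<^sub>P table_algebra M B"
proof -
  define g :: "complex ^ 2 \<Rightarrow> 'a" where "g w = (w $ 1) *\<^sub>L u + (w $ 2) *\<^sub>L v" for w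
  have "inj g"
    by (rule injI) (simp add: g_def basis_pair_eq_iff[OF uv] vec_eq_iff forall_2)
  moreover have "\<exists>w. x = g w" for x
  proof -
    obtain a b where "x = a *\<^sub>L u + b *\<^sub>L v" using basis_pair_coords[OF uv] .
    then have "x = g (vector [a, b])" by (simp add: g_def)
    then show ?thesis ..
  qed
  ultimately have bij: "bij g" by (auto simp: bij_def surj_def)
  then have gf: "g (inv g x) = x" for x by (simp add: bij_is_surj surj_f_inv_f)
  \<comment> \<open>Turns every claim about \<open>inv g\<close> into one about \<open>g\<close>,
    where coordinates are explicit.\<close>
  have fI: "inv g x = w" if "x = g w" for x w
    using that bij by (simp add: bij_is_inj)
  have g_add: "g (w + w') = g w + g w'" and g_scale: "g (c *s w) = c *\<^sub>L g w" for w w' c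
    by (simp_all add: g_def scale_left_distrib scale_right_distrib)
  have g_mul: "g (table_product M w w') = g w \<cdot> g w'" for w w'
    by (simp add: g_def mul_bilinear mul table_product_def sum_2 M'_def[symmetric]
        scale_left_distrib scale_right_distrib mult_ac add_ac)
  have g_brk: "g (table_product B w w') = \<lbrakk>g w, g w'\<rbrakk>" for w w'
    by (simp add: g_def brk_bilinear brk table_product_def sum_2 B'_def[symmetric]
        scale_left_distrib scale_right_distrib mult_ac add_ac)
  have vs: "vector_space ((*s) :: complex \<Rightarrow> complex ^ 2 \<Rightarrow> complex ^ 2)"
    by (rule vec.vector_space_axioms)
  have "Vector_Spaces.linear (scal L) (*s) (inv g)"
    unfolding Vector_Spaces.linear_iff
    using vs vector_space_axioms by (auto intro!: fI simp: g_add g_scale gf)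
  moreover have "bij (inv g)" using bij by (rule bij_imp_bij_inv)
  moreover have "inv g (x \<cdot> y) = table_product M (inv g x) (inv g y)" for x y
    by (rule fI) (simp add: g_mul gf)
  moreover have "inv g \<lbrakk>x, y\<rbrakk> = table_product B (inv g x) (inv g y)" for x y
    by (rule fI) (simp add: g_brk gf)
  ultimately show ?thesis
    unfolding lp_isomorphic_def table_algebra_def by auto
qed

section \<open>Brackets compatible with a given nonzero product\<close>

lemma brk_square_right: "\<lbrakk>x, \<lbrakk>y, y\<rbrakk>\<rbrakk> = 0"
  \<comment> \<open>For \<open>z = y\<close> the term
    \<open>\<lbrakk>\<lbrakk>x, y\<rbrakk>, y\<rbrakk>\<close> occurs on both sides and
    cancels.\<close>
  using leibniz[of x y y] by simp

text \<open>The derivation \<open>\<lbrakk>-, z\<rbrakk>\<close> applied to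
  \<open>e \<cdot> e = e\<close> gives \<open>D = 2 (e \<cdot> D)\<close> for
  \<open>D = \<lbrakk>e, z\<rbrakk>\<close>. Multiplying by \<open>e\<close> gives
  \<open>e \<cdot> D = 2 (e \<cdot> D)\<close>, hence \<open>e \<cdot> D = 0\<close> and
  \<open>D = 0\<close>.\<close>

lemma brk_idempotent_left:
  assumes "e \<cdot> e = e" shows "\<lbrakk>e, z\<rbrakk> = 0"
proof -
  have D: "\<lbrakk>e, z\<rbrakk> = e \<cdot> \<lbrakk>e, z\<rbrakk> + e \<cdot> \<lbrakk>e, z\<rbrakk>"
    using compat[of e e z] assms by (simp add: mul_commute)
  then have "e \<cdot> \<lbrakk>e, z\<rbrakk> = e \<cdot> (e \<cdot> \<lbrakk>e, z\<rbrakk> + e \<cdot> \<lbrakk>e, z\<rbrakk>)" by (rule arg_cong)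
  also have "\<dots> = e \<cdot> \<lbrakk>e, z\<rbrakk> + e \<cdot> \<lbrakk>e, z\<rbrakk>"
    by (simp add: mul_bilinear assms flip: mul_assoc)
  finally show ?thesis using D by simp
qed

lemma isomorphic_L4:
  assumes "basis_pair u v" "u \<cdot> u = u" "v \<cdot> v = v" "u \<cdot> v = 0"
  shows "L \<cong>\<^sub>L\<^sub>P L4"
  unfolding L4_def using assms mul_commute[of v u]
  by (intro lp_isomorphic_table_algebraI[of u v])
    (simp_all add: table_entry_def axis_def brk_idempotent_left)

text \<open>If \<open>\<lbrakk>n, n\<rbrakk> = d n\<close>, then
  \<open>0 = \<lbrakk>n, \<lbrakk>n, n\<rbrakk>\<rbrakk> = d^2 n\<close>, so only the eigenvalue at
  \<open>e\<close> survives; it becomes the parameter of \<open>L5\<close> and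
  \<open>L6\<close>.\<close>

lemma brk_eigenvector:
  assumes uv: "basis_pair e n" and "\<And>z. \<exists>c. \<lbrakk>n, z\<rbrakk> = c *\<^sub>L n"
  obtains c where "\<lbrakk>n, e\<rbrakk> = c *\<^sub>L n" "\<lbrakk>n, n\<rbrakk> = 0"
proof -
  obtain c d where c: "\<lbrakk>n, e\<rbrakk> = c *\<^sub>L n" and d: "\<lbrakk>n, n\<rbrakk> = d *\<^sub>L n" using assms(2) by metis
  have "(d * d) *\<^sub>L n = 0" using brk_square_right[of n n] d by (simp add: brk_bilinear)
  then have "d = 0" using basis_pair_nonzero[OF uv] by simp
  with d have "\<lbrakk>n, n\<rbrakk> = 0" by simp
  with c show thesis by (rule that)
qed

lemma isomorphic_L5:
  assumes uv: "basis_pair e n" and "e \<cdot> e = e" "e \<cdot> n = n" "n \<cdot> n = 0"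
  shows "\<exists>\<alpha>. L \<cong>\<^sub>L\<^sub>P L5 \<alpha>"
proof -
  have ne: "n \<cdot> e = n" using assms by (simp add: mul_commute)
  have "\<exists>c. \<lbrakk>n, z\<rbrakk> = c *\<^sub>L n" for z
  proof -
    obtain a b where ab: "\<lbrakk>n, z\<rbrakk> = a *\<^sub>L e + b *\<^sub>L n" using basis_pair_coords[OF uv] .
    \<comment> \<open>Differentiating \<open>n \<cdot> n = 0\<close> gives
      \<open>0 = 2 (n \<cdot> \<lbrakk>n, z\<rbrakk>) = 2 a n\<close>.\<close>
    have "(2 * a) *\<^sub>L n = 0"
      using compat[of n n z] ab assms ne by (simp add: mul_bilinear brk_bilinear scale_double)
    then have "a = 0" using basis_pair_nonzero[OF uv] by simp
    with ab show ?thesis by auto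
  qed
  then obtain c where "\<lbrakk>n, e\<rbrakk> = c *\<^sub>L n" "\<lbrakk>n, n\<rbrakk> = 0" using brk_eigenvector[OF uv] by metis
  then have "L \<cong>\<^sub>L\<^sub>P L5 c"
    unfolding L5_def using assms ne
    by (intro lp_isomorphic_table_algebraI[of e n])
      (simp_all add: table_entry_def axis_def brk_idempotent_left)
  then show ?thesis ..
qed

lemma isomorphic_L6:
  assumes uv: "basis_pair e n" and "e \<cdot> e = e" "e \<cdot> n = 0" "n \<cdot> n = 0"
  shows "\<exists>\<alpha>. L \<cong>\<^sub>L\<^sub>P L6 \<alpha>"
proof -
  have ne: "n \<cdot> e = 0" using assms by (simp add: mul_commute)
  have "\<exists>c. \<lbrakk>n, z\<rbrakk> = c *\<^sub>L n" for z
  proof -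
    obtain a b where ab: "\<lbrakk>n, z\<rbrakk> = a *\<^sub>L e + b *\<^sub>L n" using basis_pair_coords[OF uv] .
    \<comment> \<open>Differentiating \<open>e \<cdot> n = 0\<close> and using
      \<open>\<lbrakk>e, z\<rbrakk> = 0\<close> leaves
      \<open>0 = e \<cdot> \<lbrakk>n, z\<rbrakk> = a e\<close>.\<close>
    have "a *\<^sub>L e = 0"
      using compat[of e n z] ab assms ne
      by (simp add: mul_bilinear brk_bilinear brk_idempotent_left)
    then have "a = 0" using basis_pair_nonzero[OF uv] by simp
    with ab show ?thesis by auto
  qed
  then obtain c where "\<lbrakk>n, e\<rbrakk> = c *\<^sub>L n" "\<lbrakk>n, n\<rbrakk> = 0" using brk_eigenvector[OF uv] by metis
  then have "L \<cong>\<^sub>L\<^sub>P L6 c"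
    unfolding L6_def using assms ne
    by (intro lp_isomorphic_table_algebraI[of e n])
      (simp_all add: table_entry_def axis_def brk_idempotent_left)
  then show ?thesis ..
qed

text \<open>Since \<open>v = u \<cdot> u\<close>, the derivation rule fixes
  \<open>\<lbrakk>v, z\<rbrakk>\<close> from \<open>\<lbrakk>u, z\<rbrakk>\<close>. Of the four
  coordinates of \<open>\<lbrakk>u, u\<rbrakk>\<close> and \<open>\<lbrakk>u, v\<rbrakk>\<close>,
  the Leibniz identity kills \<open>a'\<close>, \<open>a\<close> and \<open>b'\<close> in this
  order; \<open>b\<close> remains as \<alpha>.\<close>

lemma isomorphic_L7:
  assumes uv: "basis_pair u v" and mul: "u \<cdot> u = v" "u \<cdot> v = 0" "v \<cdot> v = 0"
  shows "\<exists>\<alpha>. L \<cong>\<^sub>L\<^sub>P L7 \<alpha>"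
proof -
  have vu: "v \<cdot> u = 0" using assms by (simp add: mul_commute)
  note nz = basis_pair_nonzero[OF uv]
  have D: "\<lbrakk>v, z\<rbrakk> = (2 * a) *\<^sub>L v" if "\<lbrakk>u, z\<rbrakk> = a *\<^sub>L u + b *\<^sub>L v" for a b z
    using compat[of u u z] that mul vu
    by (simp add: mul_bilinear scale_double)
  obtain a b where uu: "\<lbrakk>u, u\<rbrakk> = a *\<^sub>L u + b *\<^sub>L v" using basis_pair_coords[OF uv] .
  obtain a' b' where uv': "\<lbrakk>u, v\<rbrakk> = a' *\<^sub>L u + b' *\<^sub>L v" using basis_pair_coords[OF uv] .
  note vu' = D[OF uu] and vv = D[OF uv']
  have "(4 * (a' * a')) *\<^sub>L v = 0"
    using brk_square_right[of v v] vv by (simp add: brk_bilinear mult_ac)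
  then have a': "a' = 0" using nz by simp
  have "(a * a) *\<^sub>L u + (a * b + b * b') *\<^sub>L v = 0"
    using brk_square_right[of u u] uu uv' a'
    by (simp add: brk_bilinear scale_left_distrib scale_right_distrib add_ac)
  from basis_pairD(1)[OF uv this] have a: "a = 0" by simp
  have "(b' * b') *\<^sub>L v = 0"
    using leibniz[of u u v] uu uv' vu' vv a a' by (simp add: brk_bilinear)
  then have b': "b' = 0" using nz by simp
  have "L \<cong>\<^sub>L\<^sub>P L7 b"
    unfolding L7_def using assms vu uu uv' vu' vv a a' b'
    by (intro lp_isomorphic_table_algebraI[of u v])
      (simp_all add: table_entry_def axis_def)
  then show ?thesis ..
qed

section \<open>Classification when the commutative product is nonzero\<close>

lemma basis_pair_comb:
  assumes uv: "basis_pair u v" and "a * d - b * c \<noteq> 0"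
  shows "basis_pair (a *\<^sub>L u + b *\<^sub>L v) (c *\<^sub>L u + d *\<^sub>L v)"
  unfolding basis_pair_def
proof (intro allI impI)
  fix s t assume "s *\<^sub>L (a *\<^sub>L u + b *\<^sub>L v) + t *\<^sub>L (c *\<^sub>L u + d *\<^sub>L v) = 0"
  then have "(s * a + t * c) *\<^sub>L u + (s * b + t * d) *\<^sub>L v = 0"
    by (simp add: scale_left_distrib scale_right_distrib add_ac)
  from basis_pairD[OF uv this] have *: "s * a + t * c = 0" "s * b + t * d = 0" .
  \<comment> \<open>Cramer's rule: the determinant times each coefficient is a combination of the
    two equations.\<close>
  have "s * (a * d - b * c) = d * (s * a + t * c) - c * (s * b + t * d)"
    "t * (a * d - b * c) = a * (s * b + t * d) - b * (s * a + t * c)"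
    by (simp_all add: algebra_simps)
  then have "s * (a * d - b * c) = 0" "t * (a * d - b * c) = 0"
    by (simp_all only: * mult_zero_right diff_self)
  with assms(2) show "s = 0 \<and> t = 0" by simp
qed

lemma mul_comb_unital:
  assumes "e \<cdot> e = e" "e \<cdot> v = v" "v \<cdot> v = p *\<^sub>L e + q *\<^sub>L v"
  shows "(a *\<^sub>L e + b *\<^sub>L v) \<cdot> (c *\<^sub>L e + d *\<^sub>L v)
    = (a * c + b * d * p) *\<^sub>L e + (a * d + b * c + b * d * q) *\<^sub>L v"
  using assms mul_commute[of v e]
  by (simp add: mul_bilinear scale_left_distrib scale_right_distrib mult_ac add_ac)

text \<open>Here \<open>e\<close> is a unit and \<open>v\<close> satisfies a quadratic equation over
  it: a double root leads to the dual numbers (\<open>L5\<close>), distinct roots to a product of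
  two copies of the field (\<open>L4\<close>).\<close>

lemma isomorphic_unital:
  assumes uv: "basis_pair e v" and ee: "e \<cdot> e = e" and ev: "e \<cdot> v = v"
  shows "L \<cong>\<^sub>L\<^sub>P L4 \<or> (\<exists>\<alpha>. L \<cong>\<^sub>L\<^sub>P L5 \<alpha>)"
proof -
  obtain a b where vv: "v \<cdot> v = a *\<^sub>L e + b *\<^sub>L v" using basis_pair_coords[OF uv] .
  \<comment> \<open>Completing the square makes \<open>n \<cdot> n\<close> a multiple of the
    unit.\<close>
  define n where "n = (- b / 2) *\<^sub>L e + 1 *\<^sub>L v"
  have en: "e \<cdot> n = n" by (simp add: n_def mul_bilinear ee ev)
  have nn: "n \<cdot> n = (b / 2 * (b / 2) + a) *\<^sub>L e"
    unfolding n_def mul_comb_unital[OF ee ev vv] by simp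
  have bn: "basis_pair e n"
    using basis_pair_comb[OF uv, of 1 1 0 "- b / 2"] by (simp add: n_def)
  show ?thesis
  proof (cases "b / 2 * (b / 2) + a = 0")
    case True
    then show ?thesis using isomorphic_L5[OF bn ee en] nn by simp
  next
    case False
    define r where "r = csqrt (b / 2 * (b / 2) + a)"
    have r: "r * r = b / 2 * (b / 2) + a" "r \<noteq> 0"
      using False by (simp_all add: r_def flip: power2_eq_square)
    \<comment> \<open>As \<open>n \<cdot> n = r^2 e\<close>, the elements \<open>(e + n/r)/2\<close>
      and \<open>(e - n/r)/2\<close> are orthogonal idempotents.\<close>
    define p where "p = (1 / 2) *\<^sub>L e + (1 / (2 * r)) *\<^sub>L n"
    define q where "q = (1 / 2) *\<^sub>L e + (- 1 / (2 * r)) *\<^sub>L n"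
    have nn': "n \<cdot> n = (r * r) *\<^sub>L e + 0 *\<^sub>L n" using nn r by simp
    note pq = mul_comb_unital[OF ee en nn']
    have "basis_pair p q"
      unfolding p_def q_def using r by (intro basis_pair_comb[OF bn]) (simp add: field_simps)
    moreover have "p \<cdot> p = p" "q \<cdot> q = q" "p \<cdot> q = 0"
      unfolding p_def q_def pq using r(2) by simp_all
    ultimately have "L \<cong>\<^sub>L\<^sub>P L4" by (rule isomorphic_L4)
    then show ?thesis ..
  qed
qed

lemma isomorphic_idempotent:
  assumes e0: "e \<noteq> 0" and ee: "e \<cdot> e = e"
  shows "L \<cong>\<^sub>L\<^sub>P L4 \<or> (\<exists>\<alpha>. L \<cong>\<^sub>L\<^sub>P L5 \<alpha>) \<or> (\<exists>\<alpha>. L \<cong>\<^sub>L\<^sub>P L6 \<alpha>)"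
proof -
  obtain w where w: "basis_pair e w" using basis_pair_extend[OF e0] .
  \<comment> \<open>Multiplication by \<open>e\<close> is a projection fixing \<open>e\<close>. Its
    range is either the whole plane, making \<open>e\<close> a unit, or the line of
    \<open>e\<close>.\<close>
  have eew: "e \<cdot> (e \<cdot> w) = e \<cdot> w" using ee by (simp flip: mul_assoc)
  show ?thesis
  proof (cases "basis_pair e (e \<cdot> w)")
    case True
    then show ?thesis using isomorphic_unital[OF _ ee eew] by blast
  next
    case False
    then obtain s where s: "e \<cdot> w = s *\<^sub>L e" using basis_pair_iff[OF e0] by auto
    \<comment> \<open>\<open>v = w - e \<cdot> w\<close> spans the kernel of the projection; by
      associativity \<open>v \<cdot> v\<close> lies there too, so its \<open>e\<close>-coordinate
      vanishes.\<close>
    define v where "v = (- s) *\<^sub>L e + 1 *\<^sub>L w"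
    have ev: "e \<cdot> v = 0" by (simp add: v_def mul_bilinear ee s)
    have bv: "basis_pair e v"
      using basis_pair_comb[OF w, of 1 1 0 "- s"] by (simp add: v_def)
    obtain a b where vv: "v \<cdot> v = a *\<^sub>L e + b *\<^sub>L v" using basis_pair_coords[OF bv] .
    have "a *\<^sub>L e = e \<cdot> (v \<cdot> v)" by (simp add: vv mul_bilinear ee ev)
    also have "\<dots> = 0" by (simp add: ev mul_bilinear flip: mul_assoc)
    finally have vv': "v \<cdot> v = b *\<^sub>L v" using vv by simp
    show ?thesis
    proof (cases "b = 0")
      case True
      then show ?thesis using isomorphic_L6[OF bv ee ev] vv' by simp
    next
      case False
      \<comment> \<open>Rescaling \<open>v\<close> gives a second idempotent, orthogonal to
        \<open>e\<close>.\<close>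
      have "basis_pair e ((1 / b) *\<^sub>L v)"
        using basis_pair_comb[OF bv, of 1 "1 / b" 0 0] False by simp
      then have "L \<cong>\<^sub>L\<^sub>P L4"
        using False by (intro isomorphic_L4[of e "(1 / b) *\<^sub>L v"])
          (simp_all add: mul_bilinear ee ev vv')
      then show ?thesis ..
    qed
  qed
qed

lemma isomorphic_mul_nonzero:
  assumes "x \<cdot> y \<noteq> 0"
  shows "L \<cong>\<^sub>L\<^sub>P L4 \<or> (\<exists>\<alpha>. L \<cong>\<^sub>L\<^sub>P L5 \<alpha>) \<or> (\<exists>\<alpha>. L \<cong>\<^sub>L\<^sub>P L6 \<alpha>) \<or> (\<exists>\<alpha>. L \<cong>\<^sub>L\<^sub>P L7 \<alpha>)"
proof -
  \<comment> \<open>Polarization: if all squares vanished, expanding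
    \<open>(x + y) \<cdot> (x + y)\<close> would give \<open>2 (x \<cdot> y) = 0\<close>.\<close>
  have "\<exists>x. x \<cdot> x \<noteq> 0"
  proof (rule ccontr)
    assume "\<nexists>x. x \<cdot> x \<noteq> 0"
    then have sq: "z \<cdot> z = 0" for z by blast
    have "(1 + 1) *\<^sub>L (x \<cdot> y) = x \<cdot> x + x \<cdot> y + (y \<cdot> x + y \<cdot> y)"
      unfolding scale_left_distrib by (simp add: sq mul_commute[of y x])
    also have "\<dots> = (x + y) \<cdot> (x + y)" by (simp only: mul_bilinear add_ac)
    finally show False using assms by (simp add: sq)
  qed
  then obtain x where xx: "x \<cdot> x \<noteq> 0" ..
  then have x0: "x \<noteq> 0" by (auto simp: mul_bilinear)
  show ?thesis
  proof (cases "basis_pair x (x \<cdot> x)")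
    case False
    then obtain c where c: "x \<cdot> x = c *\<^sub>L x" using basis_pair_iff[OF x0] by auto
    then have "c \<noteq> 0" using xx by auto
    then show ?thesis
      using isomorphic_idempotent[of "(1 / c) *\<^sub>L x"] c x0 by (auto simp: mul_bilinear)
  next
    case True
    define y where "y = x \<cdot> x"
    have xy: "basis_pair x y" using True by (simp add: y_def)
    obtain p q where p: "x \<cdot> y = p *\<^sub>L x + q *\<^sub>L y" using basis_pair_coords[OF xy] .
    \<comment> \<open>The whole product is thus determined by \<open>p\<close> and
      \<open>q\<close>.\<close>
    have yy: "y \<cdot> y = x \<cdot> (x \<cdot> y)" by (simp add: y_def mul_assoc)
    consider "p = 0" "q = 0" | "p = 0" "q \<noteq> 0" | "p \<noteq> 0" by blast
    then show ?thesis
    proof cases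
      case 1
      then show ?thesis
        using isomorphic_L7[OF xy y_def[symmetric]] p yy by (simp add: mul_bilinear)
    next
      case 2
      \<comment> \<open>Here \<open>x \<cdot> y = q y\<close>, so
        \<open>y \<cdot> y = q^2 y\<close>, and dividing \<open>y\<close> by \<open>q^2\<close>
        gives an idempotent.\<close>
      then have "((1 / (q * q)) *\<^sub>L y) \<cdot> ((1 / (q * q)) *\<^sub>L y) = (1 / (q * q)) *\<^sub>L y"
        using p yy by (simp add: mul_bilinear)
      then show ?thesis
        using isomorphic_idempotent[of "(1 / (q * q)) *\<^sub>L y"] basis_pair_nonzero[OF xy] 2 by auto
    next
      case 3
      \<comment> \<open>\<open>x\<close> generates the algebra and \<open>x\<^sup>3 = p x + q x\<^sup>2\<close> with \<open>p \<noteq> 0\<close>, so \<open>(x\<^sup>2 - q x) / p\<close> is a unit.\<close>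
      define e where "e = (- q / p) *\<^sub>L x + (1 / p) *\<^sub>L y"
      have ex: "x \<cdot> e = x"
        using 3 by (simp add: e_def mul_bilinear p scale_right_distrib flip: y_def)
      then have "e \<cdot> x = x" by (simp add: mul_commute)
      then have "e \<cdot> y = y" by (simp add: y_def flip: mul_assoc)
      with \<open>e \<cdot> x = x\<close> have "e \<cdot> e = e"
        \<comment> \<open>Only the second factor is expanded, as \<open>e\<close> is known to fix
          \<open>x\<close> and \<open>y\<close>.\<close>
        by (subst (2) e_def) (simp add: mul_bilinear, simp add: e_def)
      moreover have "e \<noteq> 0" using ex x0 by (auto simp: mul_bilinear)
      ultimately show ?thesis using isomorphic_idempotent by blast
    qed
  qed
qed

section \<open>Classification when the commutative product is zero\<close>

lemma isomorphic_L3: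
  assumes sq: "\<And>x. \<lbrakk>x, x\<rbrakk> = 0" and mul0: "\<And>x y. x \<cdot> y = 0" and "\<lbrakk>x, y\<rbrakk> \<noteq> 0"
  shows "L \<cong>\<^sub>L\<^sub>P L3"
proof -
  have anti: "\<lbrakk>t, s\<rbrakk> = - \<lbrakk>s, t\<rbrakk>" for s t
  proof -
    have "\<lbrakk>s + t, s + t\<rbrakk> = \<lbrakk>s, s\<rbrakk> + \<lbrakk>t, s\<rbrakk> + (\<lbrakk>s, t\<rbrakk> + \<lbrakk>t, t\<rbrakk>)"
      by (simp only: brk_bilinear)
    then show ?thesis by (simp add: sq eq_neg_iff_add_eq_0)
  qed
  have L3: ?thesis if "basis_pair u v" "\<lbrakk>u, v\<rbrakk> = v" for u v
    unfolding L3_def using that anti[of v u]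
    by (intro lp_isomorphic_table_algebraI[of u v]) (simp_all add: table_entry_def axis_def sq mul0)
  have "x \<noteq> 0" using assms(3) by (auto simp: brk_bilinear)
  moreover have "y \<notin> range (\<lambda>c. c *\<^sub>L x)" using assms(3) sq by (auto simp: brk_bilinear)
  ultimately have xy: "basis_pair x y" by (simp add: basis_pair_iff)
  define w where "w = \<lbrakk>x, y\<rbrakk>"
  obtain a b where ab: "w = a *\<^sub>L x + b *\<^sub>L y" using basis_pair_coords[OF xy] .
  \<comment> \<open>Both \<open>x\<close> and \<open>y\<close> act on \<open>w\<close> by scalars,
    \<open>b\<close> and \<open>-a\<close>. These are not both zero since
    \<open>w \<noteq> 0\<close>, so rescaling \<open>x\<close> or \<open>y\<close> yields
    \<open>u\<close> with \<open>\<lbrakk>u, w\<rbrakk> = w\<close>.\<close>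
  have xw: "\<lbrakk>x, w\<rbrakk> = b *\<^sub>L w" and yw: "\<lbrakk>y, w\<rbrakk> = (- a) *\<^sub>L w"
    using anti[of y x] by (subst ab, simp add: brk_bilinear sq flip: w_def)+
  show ?thesis
  proof (cases "b = 0")
    case False
    then have "basis_pair ((1 / b) *\<^sub>L x) w"
      using basis_pair_comb[OF xy, of "1 / b" b 0 a] ab by simp
    then show ?thesis using L3 xw False by (simp add: brk_bilinear)
  next
    case True
    then have a: "a \<noteq> 0" using ab assms(3) by (auto simp: w_def)
    then have "basis_pair ((- 1 / a) *\<^sub>L y) w"
      using basis_pair_comb[OF xy, of 0 b "- 1 / a" a] ab by simp
    then show ?thesis using L3 yw a by (simp add: brk_bilinear)
  qed
qed

text \<open>The square \<open>n = \<lbrakk>x, x\<rbrakk>\<close> satisfies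
  \<open>\<lbrakk>z, n\<rbrakk> = 0\<close> for all \<open>z\<close>. Hence \<open>x\<close> is no
  multiple of \<open>n\<close>, and in the basis \<open>n, x\<close> only
  \<open>\<lbrakk>n, x\<rbrakk>\<close> is left to determine.\<close>

lemma isomorphic_L1_L2:
  assumes mul0: "\<And>x y. x \<cdot> y = 0" and xx: "\<lbrakk>x, x\<rbrakk> \<noteq> 0"
  shows "L \<cong>\<^sub>L\<^sub>P L1 \<or> L \<cong>\<^sub>L\<^sub>P L2"
proof -
  define n where "n = \<lbrakk>x, x\<rbrakk>"
  have n: "\<lbrakk>z, n\<rbrakk> = 0" for z by (simp add: n_def brk_square_right)
  have "x \<notin> range (\<lambda>c. c *\<^sub>L n)"
  proof
    assume "x \<in> range (\<lambda>c. c *\<^sub>L n)"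
    then obtain c where "x = c *\<^sub>L n" by auto
    then have "\<lbrakk>x, x\<rbrakk> = c *\<^sub>L \<lbrakk>x, n\<rbrakk>" by (metis brk_bilinear(8))
    then show False using xx n by simp
  qed
  then have nx: "basis_pair n x" using xx by (simp add: basis_pair_iff n_def)
  obtain b a where ab: "\<lbrakk>n, x\<rbrakk> = b *\<^sub>L n + a *\<^sub>L x" using basis_pair_coords[OF nx] .
  \<comment> \<open>The Leibniz identity for \<open>x, n, x\<close> reduces to
    \<open>0 = \<lbrakk>x, \<lbrakk>n, x\<rbrakk>\<rbrakk> = a n\<close>.\<close>
  have "a *\<^sub>L n = 0"
    using leibniz[of x n x] n ab by (simp add: brk_bilinear flip: n_def)
  then have nxb: "\<lbrakk>n, x\<rbrakk> = b *\<^sub>L n" using ab basis_pair_nonzero[OF nx] by simp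
  show ?thesis
  proof (cases "b = 0")
    case True
    then have "L \<cong>\<^sub>L\<^sub>P L1"
      unfolding L1_def using basis_pair_swap[OF nx] n nxb
      by (intro lp_isomorphic_table_algebraI[of x n])
        (simp_all add: table_entry_def axis_def mul0 flip: n_def)
    then show ?thesis ..
  next
    case False
    \<comment> \<open>The factor \<open>1 / b\<close> normalises
      \<open>\<lbrakk>n, v\<rbrakk>\<close> to \<open>n\<close>; the multiple of \<open>n\<close> is
      chosen to cancel the square of \<open>x / b\<close>, so that
      \<open>\<lbrakk>v, v\<rbrakk> = 0\<close>.\<close>
    define v where "v = (- 1 / (b * b)) *\<^sub>L n + (1 / b) *\<^sub>L x"
    have "basis_pair n v"
      using basis_pair_comb[OF nx, of 1 "1 / b" 0 "- 1 / (b * b)"] False by (simp add: v_def)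
    moreover have "\<lbrakk>n, v\<rbrakk> = n" using False by (simp add: v_def brk_bilinear n nxb)
    moreover have "\<lbrakk>v, v\<rbrakk> = 0"
      using False by (simp add: v_def brk_bilinear n nxb flip: n_def)
    ultimately have "L \<cong>\<^sub>L\<^sub>P L2"
      unfolding L2_def using n
      by (intro lp_isomorphic_table_algebraI[of n v]) (simp_all add: table_entry_def axis_def mul0)
    then show ?thesis ..
  qed
qed

end

theorem theorem16:
  fixes L :: "'a::ab_group_add two_product_space"
  assumes "leibniz_poisson L"
    and "vector_space.dim (scal L) UNIV = 2"
    and "lp_nonzero L"
  shows "L \<cong>\<^sub>L\<^sub>P L1 \<or> L \<cong>\<^sub>L\<^sub>P L2 \<or> L \<cong>\<^sub>L\<^sub>P L3 \<or>
         L \<cong>\<^sub>L\<^sub>P L4 \<or> (\<exists>\<alpha>. L \<cong>\<^sub>L\<^sub>P L5 \<alpha>) \<or> (\<exists>\<alpha>. L \<cong>\<^sub>L\<^sub>P L6 \<alpha>) \<or> (\<exists>\<alpha>. L \<cong>\<^sub>L\<^sub>P L7 \<alpha>)"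
proof -
  interpret leibniz_poisson_plane L
    using assms(1,2) by (simp add: leibniz_poisson_plane_def leibniz_poisson_plane_axioms_def)
  show ?thesis
  proof (cases "\<forall>x y. mul L x y = 0")
    case False
    then show ?thesis using isomorphic_mul_nonzero by blast
  next
    case True
    with assms(3) obtain x y where "brk L x y \<noteq> 0" by (auto simp: lp_nonzero_def)
    with True show ?thesis
      using isomorphic_L1_L2 isomorphic_L3 by (cases "\<forall>x. brk L x x = 0") blast+
  qed
qed

end
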